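(* There is an algorithm which, given as input two finite $C(2)$ monoid presentations, decides whether the monoids they present are isomorphic.
   Context: A monoid presentation $\langle \mathscr{A} \mid \mathscr{R} \rangle$ consists of an alphabet $\mathscr{A}$ and a set $\mathscr{R} \subseteq \mathscr{A}^* \times \mathscr{A}^*$ of relations (finite if both are finite); the monoid presented is $\mathscr{A}^*$ modulo the smallest congruence containing $\mathscr{R}$. A relation word is a word occurring as one side of a relation. A piece is a word which occurs as a factor of two distinct relation words, or in two different (possibly overlapping) positions within one relation word; the empty word is always a piece. The presentation is $C(2)$ if no relation word can be written as a product of strictly fewer than $2$ pieces. *)

theory Defs
  imports Main "HOL-Library.Nat_Bijection"
begin

text \<open>A finite monoid presentation: the alphabet is {0..<n} (any finite alphabet, up to
renaming), relations are a finite list of pairs of words.\<close>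

type_synonym word = "nat list"
type_synonym presentation = "nat \<times> (word \<times> word) list"

definition alph :: "presentation \<Rightarrow> nat set" where
  "alph P = {0..<fst P}"

definition words :: "presentation \<Rightarrow> word set" where
  "words P = {w. set w \<subseteq> alph P}"

definition rels :: "presentation \<Rightarrow> (word \<times> word) set" where
  "rels P = set (snd P)"

definition well_formed :: "presentation \<Rightarrow> bool" where
  "well_formed P \<longleftrightarrow> (\<forall>(l, r) \<in> rels P. l \<in> words P \<and> r \<in> words P)"

inductive pcong :: "presentation \<Rightarrow> word \<Rightarrow> word \<Rightarrow> bool" for P where
  refl: "w \<in> words P \<Longrightarrow> pcong P w w"
| rel: "(l, r) \<in> rels P \<Longrightarrow> u \<in> words P \<Longrightarrow> v \<in> words P \<Longrightarrow> pcong P (u @ l @ v) (u @ r @ v)"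
| sym: "pcong P u v \<Longrightarrow> pcong P v u"
| trans: "pcong P u v \<Longrightarrow> pcong P v w \<Longrightarrow> pcong P u w"

text \<open>Isomorphism of the presented monoids: a map on representatives inducing a bijective
monoid homomorphism between the quotients.\<close>
definition presented_iso :: "presentation \<Rightarrow> presentation \<Rightarrow> bool" where
  "presented_iso P Q \<longleftrightarrow> (\<exists>h :: word \<Rightarrow> word.
      (\<forall>u \<in> words P. h u \<in> words Q) \<and>
      (\<forall>u \<in> words P. \<forall>v \<in> words P. pcong P u v \<longleftrightarrow> pcong Q (h u) (h v)) \<and>
      (\<forall>w \<in> words Q. \<exists>u \<in> words P. pcong Q (h u) w) \<and>
      (\<forall>u \<in> words P. \<forall>v \<in> words P. pcong Q (h (u @ v)) (h u @ h v)) \<and>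
      pcong Q (h []) [])"

definition relation_words :: "presentation \<Rightarrow> word set" where
  "relation_words P = fst ` rels P \<union> snd ` rels P"

definition occurs_at :: "word \<Rightarrow> word \<Rightarrow> nat \<Rightarrow> bool" where
  "occurs_at p w i \<longleftrightarrow> i + length p \<le> length w \<and> take (length p) (drop i w) = p"

definition is_factor :: "word \<Rightarrow> word \<Rightarrow> bool" where
  "is_factor p w \<longleftrightarrow> (\<exists>i. occurs_at p w i)"

definition piece :: "presentation \<Rightarrow> word \<Rightarrow> bool" where
  "piece P p \<longleftrightarrow> p = [] \<or>
     (\<exists>w1 \<in> relation_words P. \<exists>w2 \<in> relation_words P. w1 \<noteq> w2 \<and> is_factor p w1 \<and> is_factor p w2) \<or>
     (\<exists>w \<in> relation_words P. \<exists>i j. i \<noteq> j \<and> occurs_at p w i \<and> occurs_at p w j)"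

definition small_overlap :: "nat \<Rightarrow> presentation \<Rightarrow> bool" where
  "small_overlap k P \<longleftrightarrow> (\<forall>r \<in> relation_words P.
      \<not> (\<exists>ps. length ps < k \<and> (\<forall>p \<in> set ps. piece P p) \<and> concat ps = r))"

abbreviation C2 :: "presentation \<Rightarrow> bool" where
  "C2 P \<equiv> small_overlap 2 P"

datatype recf = Zero | Succ | Proj nat | Comp recf "recf list" | Prim recf recf | Mn recf

inductive eval :: "recf \<Rightarrow> nat list \<Rightarrow> nat \<Rightarrow> bool" where
  zero: "eval Zero xs 0"
| succ: "eval Succ (x # xs) (Suc x)"
| proj: "i < length xs \<Longrightarrow> eval (Proj i) xs (xs ! i)"
| comp: "list_all2 (\<lambda>g y. eval g xs y) gs ys \<Longrightarrow> eval f ys z \<Longrightarrow> eval (Comp f gs) xs z"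
| prim0: "eval f xs y \<Longrightarrow> eval (Prim f g) (0 # xs) y"
| primS: "eval (Prim f g) (n # xs) y \<Longrightarrow> eval g (n # y # xs) z \<Longrightarrow> eval (Prim f g) (Suc n # xs) z"
| mn: "eval f (n # xs) 0 \<Longrightarrow> (\<forall>m<n. \<exists>y. y > 0 \<and> eval f (m # xs) y) \<Longrightarrow> eval (Mn f) xs n"

definition enc_word :: "word \<Rightarrow> nat" where
  "enc_word w = list_encode w"

definition enc_pres :: "presentation \<Rightarrow> nat" where
  "enc_pres P = prod_encode (fst P,
      list_encode (map (\<lambda>(l, r). prod_encode (enc_word l, enc_word r)) (snd P)))"

end

theory Submission
  imports Defs
begin

text \<open>In a C(2) presentation no relation word is empty or a proper factor of another relation word.
  Hence a relation word or a letter can be rewritten only as a whole, and its congruence class is its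
  component in the finite graph whose edges are the relations. A letter whose component contains only
  letters is indecomposable; any other letter equals a product of such indecomposable letters. So an
  isomorphism amounts to a bijection \<open>s\<close> between the components of indecomposable letters. If \<open>s\<close>
  comes from an isomorphism and \<open>l\<close>, \<open>r\<close> are distinct connected relation words of length at least 2,
  then the image of \<open>l\<close> must contain a relation word, whose preimage again contains a relation word,
  which must be \<open>l\<close> itself. Thus \<open>s\<close> maps such relation words to relation words and respects
  components, and conversely any such bijection induces an isomorphism. This is a finite search.\<close>

section \<open>Recursive functions and predicates of an environment\<close>

text \<open>A program sees an environment \<open>e\<close> of arbitrary type only through the list \<open>\<Gamma>\<close>; a bounded
  quantifier then just extends the environment by a component.\<close>

definition recursive_in :: "('e \<Rightarrow> nat) list \<Rightarrow> ('e \<Rightarrow> nat) \<Rightarrow> bool" where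
  "recursive_in \<Gamma> F \<longleftrightarrow> (\<exists>f. \<forall>e. eval f (map (\<lambda>g. g e) \<Gamma>) (F e))"

definition decidable_in :: "('e \<Rightarrow> nat) list \<Rightarrow> ('e \<Rightarrow> bool) \<Rightarrow> bool" where
  "decidable_in \<Gamma> R \<longleftrightarrow> recursive_in \<Gamma> (\<lambda>e. if R e then 1 else 0)"

lemma recursive_in_var: "F \<in> set \<Gamma> \<Longrightarrow> recursive_in \<Gamma> F"
proof -
  assume "F \<in> set \<Gamma>"
  then obtain i where i: "i < length \<Gamma>" "\<Gamma> ! i = F" by (auto simp: in_set_conv_nth)
  have "eval (Proj i) (map (\<lambda>g. g e) \<Gamma>) (F e)" for e
    using eval.proj[of i "map (\<lambda>g. g e) \<Gamma>"] i by simp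
  then show ?thesis unfolding recursive_in_def by blast
qed

text \<open>The substitution \<open>H\<close> may change the type of environments; only the entries
  of the new context must be computable in the old one. So a fact proved once for a context of
  projections carries over to every context.\<close>

lemma recursive_in_compose:
  assumes F: "recursive_in \<Delta> F" and H: "\<forall>g\<in>set \<Delta>. recursive_in \<Gamma> (\<lambda>e. g (H e))"
  shows "recursive_in \<Gamma> (\<lambda>e. F (H e))"
proof -
  obtain f where f: "\<And>d. eval f (map (\<lambda>g. g d) \<Delta>) (F d)"
    using F unfolding recursive_in_def by blast
  obtain c where c: "\<And>g e. g \<in> set \<Delta> \<Longrightarrow> eval (c g) (map (\<lambda>g. g e) \<Gamma>) (g (H e))"
    using H unfolding recursive_in_def by metis
  have "eval (Comp f (map c \<Delta>)) (map (\<lambda>g. g e) \<Gamma>) (F (H e))" for e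
    by (rule eval.comp[OF _ f]) (auto simp: list_all2_conv_all_nth intro: c)
  then show ?thesis unfolding recursive_in_def by blast
qed

lemma decidable_in_compose:
  assumes "decidable_in \<Delta> R" "\<forall>g\<in>set \<Delta>. recursive_in \<Gamma> (\<lambda>e. g (H e))"
  shows "decidable_in \<Gamma> (\<lambda>e. R (H e))"
  using recursive_in_compose[OF assms(1)[unfolded decidable_in_def] assms(2)]
  unfolding decidable_in_def .

lemma recursive_in_Suc: "recursive_in \<Gamma> x \<Longrightarrow> recursive_in \<Gamma> (\<lambda>e. Suc (x e))"
proof (rule recursive_in_compose[of "[\<lambda>n. n]" Suc])
  show "recursive_in [\<lambda>n. n] Suc" unfolding recursive_in_def by (auto intro: eval.succ)
qed simp

lemma recursive_in_const: "recursive_in \<Gamma> (\<lambda>e. n)"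
proof (induction n)
  case 0
  show ?case unfolding recursive_in_def by (auto intro: eval.zero)
qed (rule recursive_in_Suc)

text \<open>\<open>Prim\<close> hands its step the counter and the previous value in front of the
  arguments; accordingly \<open>S\<close> is judged in an environment that is a triple, with those
  two components listed first.\<close>

lemma recursive_in_rec_nat:
  assumes B: "recursive_in \<Gamma> B" and N: "recursive_in \<Gamma> N"
    and S: "recursive_in ((\<lambda>p. fst (snd p)) # (\<lambda>p. snd (snd p)) # map (\<lambda>g p. g (fst p)) \<Gamma>)
              (\<lambda>p. S (fst p) (fst (snd p)) (snd (snd p)))"
  shows "recursive_in \<Gamma> (\<lambda>e. rec_nat (B e) (S e) (N e))"
proof -
  obtain b where b: "\<And>e. eval b (map (\<lambda>g. g e) \<Gamma>) (B e)"
    using B unfolding recursive_in_def by blast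
  obtain s where s: "\<And>e n y. eval s (n # y # map (\<lambda>g. g e) \<Gamma>) (S e n y)"
    using S unfolding recursive_in_def by (auto simp: comp_def)
  have "eval (Prim b s) (n # map (\<lambda>g. g e) \<Gamma>) (rec_nat (B e) (S e) n)" for n e
    by (induction n) (auto intro: eval.prim0 eval.primS b s)
  then have "recursive_in (snd # map (\<lambda>g p. g (fst p)) \<Gamma>)
      (\<lambda>p. rec_nat (B (fst p)) (S (fst p)) (snd p))"
    unfolding recursive_in_def by (auto simp: comp_def)
  \<comment> \<open>Up to here the counter is a free component of the environment; now
    \<open>N e\<close> takes its place.\<close>
  from recursive_in_compose[OF this, of \<Gamma> "\<lambda>e. (e, N e)"] N show ?thesis
    by (simp add: recursive_in_var)
qed

section \<open>Case distinction, arithmetic, bounded quantifiers and search\<close>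

text \<open>A conditional is a recursion of length 0 or 1: no step leaves \<open>y e\<close>, a
  single step replaces it by \<open>x e\<close>.\<close>

lemma recursive_in_if:
  assumes "decidable_in \<Gamma> R" "recursive_in \<Gamma> x" "recursive_in \<Gamma> y"
  shows "recursive_in \<Gamma> (\<lambda>e. if R e then x e else y e)"
proof -
  have "recursive_in (h1 # h2 # map (\<lambda>g p. g (fst p)) \<Gamma>) (\<lambda>p. x (fst p))" for h1 h2 :: "'a \<times> nat \<times> nat \<Rightarrow> nat"
    by (rule recursive_in_compose[OF assms(2)]) (auto intro: recursive_in_var)
  then have "recursive_in \<Gamma> (\<lambda>e. rec_nat (y e) (\<lambda>_ _. x e) (if R e then 1 else 0))"
    by (intro recursive_in_rec_nat assms assms(1)[unfolded decidable_in_def])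
  also have "(\<lambda>e. rec_nat (y e) (\<lambda>_ _. x e) (if R e then 1 else 0)) = (\<lambda>e. if R e then x e else y e)"
    by auto
  finally show ?thesis .
qed

text \<open>The propositional connectives below all reduce to this conditional.\<close>

lemma decidable_in_if:
  assumes "decidable_in \<Gamma> R" "decidable_in \<Gamma> S" "decidable_in \<Gamma> T"
  shows "decidable_in \<Gamma> (\<lambda>e. if R e then S e else T e)"
proof -
  have "(\<lambda>e. if if R e then S e else T e then 1 else 0 :: nat) =
      (\<lambda>e. if R e then (if S e then 1 else 0) else (if T e then 1 else 0))" by auto
  then show ?thesis
    using recursive_in_if[OF assms(1) assms(2,3)[unfolded decidable_in_def]]
    unfolding decidable_in_def by simp
qed

lemma decidable_in_const: "decidable_in \<Gamma> (\<lambda>e. b)"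
  unfolding decidable_in_def by (rule recursive_in_const)

lemma decidable_in_not: "decidable_in \<Gamma> R \<Longrightarrow> decidable_in \<Gamma> (\<lambda>e. \<not> R e)"
  using decidable_in_if[of \<Gamma> R "\<lambda>_. False" "\<lambda>_. True"]
  by (simp add: decidable_in_const if_bool_eq_conj)

lemma decidable_in_and:
  "decidable_in \<Gamma> R \<Longrightarrow> decidable_in \<Gamma> S \<Longrightarrow> decidable_in \<Gamma> (\<lambda>e. R e \<and> S e)"
  using decidable_in_if[of \<Gamma> R S "\<lambda>_. False"]
  by (simp add: decidable_in_const if_bool_eq_disj)

lemma decidable_in_or:
  "decidable_in \<Gamma> R \<Longrightarrow> decidable_in \<Gamma> S \<Longrightarrow> decidable_in \<Gamma> (\<lambda>e. R e \<or> S e)"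
  using decidable_in_not[OF decidable_in_and[OF decidable_in_not decidable_in_not], of \<Gamma> R S]
  by simp

lemma decidable_in_imp:
  "decidable_in \<Gamma> R \<Longrightarrow> decidable_in \<Gamma> S \<Longrightarrow> decidable_in \<Gamma> (\<lambda>e. R e \<longrightarrow> S e)"
  using decidable_in_not[OF decidable_in_and[OF _ decidable_in_not], of \<Gamma> R S] by simp

lemma decidable_in_iff:
  "decidable_in \<Gamma> R \<Longrightarrow> decidable_in \<Gamma> S \<Longrightarrow> decidable_in \<Gamma> (\<lambda>e. R e = S e)"
proof -
  assume *: "decidable_in \<Gamma> R" "decidable_in \<Gamma> S"
  have "(\<lambda>e. R e = S e) = (\<lambda>e. if R e then S e else \<not> S e)" by auto
  then show ?thesis using decidable_in_if[OF * decidable_in_not[OF *(2)]] by simp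
qed

lemma decidable_in_eq_0: "recursive_in \<Gamma> x \<Longrightarrow> decidable_in \<Gamma> (\<lambda>e. x e = 0)"
proof -
  assume x: "recursive_in \<Gamma> x"
  have "(\<lambda>e. if x e = 0 then 1 else 0) = (\<lambda>e. rec_nat 1 (\<lambda>_ _. 0) (x e) :: nat)"
    by (rule ext, case_tac "x e") auto
  then show ?thesis unfolding decidable_in_def
    by (simp only:) (intro recursive_in_rec_nat x recursive_in_const)
qed

lemma recursive_in_pred: "recursive_in \<Gamma> x \<Longrightarrow> recursive_in \<Gamma> (\<lambda>e. x e - 1)"
proof -
  assume x: "recursive_in \<Gamma> x"
  have "(\<lambda>e. x e - 1) = (\<lambda>e. rec_nat 0 (\<lambda>n _. n) (x e))"
    by (rule ext, case_tac "x e") auto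
  then show ?thesis
    by (simp only:) (intro recursive_in_rec_nat x recursive_in_const, simp add: recursive_in_var)
qed

lemma recursive_in_diff:
  "recursive_in \<Gamma> x \<Longrightarrow> recursive_in \<Gamma> y \<Longrightarrow> recursive_in \<Gamma> (\<lambda>e. x e - y e)"
proof -
  assume *: "recursive_in \<Gamma> x" "recursive_in \<Gamma> y"
  have "rec_nat a (\<lambda>_ y. y - 1) n = a - n" for a n :: nat by (induction n) auto
  then have "(\<lambda>e. x e - y e) = (\<lambda>e. rec_nat (x e) (\<lambda>_ y. y - 1) (y e))" by simp
  then show ?thesis
    by (simp only:) (intro recursive_in_rec_nat * recursive_in_pred, simp add: recursive_in_var)
qed

lemma recursive_in_add:
  "recursive_in \<Gamma> x \<Longrightarrow> recursive_in \<Gamma> y \<Longrightarrow> recursive_in \<Gamma> (\<lambda>e. x e + y e)"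
proof -
  assume *: "recursive_in \<Gamma> x" "recursive_in \<Gamma> y"
  have "rec_nat a (\<lambda>_. Suc) n = a + n" for a n :: nat by (induction n) auto
  then have "(\<lambda>e. x e + y e) = (\<lambda>e. rec_nat (x e) (\<lambda>_. Suc) (y e))" by simp
  then show ?thesis
    by (simp only:) (intro recursive_in_rec_nat * recursive_in_Suc, simp add: recursive_in_var)
qed

text \<open>Truncated subtraction turns the comparison into a test for zero.\<close>

lemma decidable_in_le:
  "recursive_in \<Gamma> x \<Longrightarrow> recursive_in \<Gamma> y \<Longrightarrow> decidable_in \<Gamma> (\<lambda>e. x e \<le> y e)"
  using decidable_in_eq_0[OF recursive_in_diff, of \<Gamma> x y] by simp

lemma decidable_in_less:
  "recursive_in \<Gamma> x \<Longrightarrow> recursive_in \<Gamma> y \<Longrightarrow> decidable_in \<Gamma> (\<lambda>e. x e < y e)"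
  using decidable_in_le[OF recursive_in_Suc, of \<Gamma> x y] by (simp add: Suc_le_eq)

lemma decidable_in_eq:
  "recursive_in \<Gamma> x \<Longrightarrow> recursive_in \<Gamma> y \<Longrightarrow> decidable_in \<Gamma> (\<lambda>e. x e = y e)"
  using decidable_in_and[OF decidable_in_le decidable_in_le, of \<Gamma> x y y x]
  by (simp add: eq_iff[symmetric])

lemma decidable_in_ex_less:
  assumes "recursive_in \<Gamma> N"
    and R: "decidable_in (snd # map (\<lambda>g p. g (fst p)) \<Gamma>) (\<lambda>p. R (fst p) (snd p))"
  shows "decidable_in \<Gamma> (\<lambda>e. \<exists>i<N e. R e i)"
proof -
  \<comment> \<open>The accumulator remembers whether a witness has been met so far.\<close>
  have "rec_nat 0 (\<lambda>n y. if R e n then 1 else y) k = (if \<exists>i<k. R e i then 1 else 0 :: nat)" for e k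
    by (induction k) (auto simp: less_Suc_eq)
  then have eq: "(\<lambda>e. if \<exists>i<N e. R e i then 1 else 0) =
      (\<lambda>e. rec_nat 0 (\<lambda>n y. if R e n then 1 else y) (N e) :: nat)" by simp
  have "decidable_in ((\<lambda>p. fst (snd p)) # (\<lambda>p. snd (snd p)) # map (\<lambda>g p. g (fst p)) \<Gamma>)
      (\<lambda>p. R (fst p) (fst (snd p)))"
    (is "decidable_in ?\<Gamma> _")
    using decidable_in_compose[OF R, of ?\<Gamma> "\<lambda>p. (fst p, fst (snd p))"]
    by (simp add: recursive_in_var)
  then show ?thesis
    unfolding decidable_in_def eq
    by (intro recursive_in_rec_nat assms recursive_in_const recursive_in_if recursive_in_var)
      (auto simp: decidable_in_def)
qed

lemma decidable_in_all_less:
  assumes "recursive_in \<Gamma> N"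
    and "decidable_in (snd # map (\<lambda>g p. g (fst p)) \<Gamma>) (\<lambda>p. R (fst p) (snd p))"
  shows "decidable_in \<Gamma> (\<lambda>e. \<forall>i<N e. R e i)"
  using decidable_in_not[OF decidable_in_ex_less[of \<Gamma> N "\<lambda>e i. \<not> R e i"]] assms
  by (simp add: decidable_in_not)

text \<open>Unbounded search for the only number on the graph; it halts because \<open>F\<close> is
  total. A function with a bounded first-order description of its graph thus needs no explicit
  program.\<close>

lemma recursive_in_graph:
  assumes "decidable_in (snd # map (\<lambda>g p. g (fst p)) \<Gamma>) (\<lambda>p. F (fst p) = snd p)"
  shows "recursive_in \<Gamma> F"
proof -
  \<comment> \<open>\<open>Mn\<close> stops at the value 0, which encodes falsity, so the search
    runs on the negated graph.\<close>
  obtain f where *: "\<And>p. eval f (map (\<lambda>g. g p) (snd # map (\<lambda>g p. g (fst p)) \<Gamma>))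
      (if F (fst p) \<noteq> snd p then 1 else 0)"
    using decidable_in_not[OF assms] unfolding decidable_in_def recursive_in_def by blast
  have f: "eval f (n # map (\<lambda>g. g e) \<Gamma>) (if F e \<noteq> n then 1 else 0)" for e n
    using *[of "(e, n)"] by (simp add: comp_def del: not_iff)
  have "eval (Mn f) (map (\<lambda>g. g e) \<Gamma>) (F e)" for e
  proof (rule eval.mn)
    show "eval f (F e # map (\<lambda>g. g e) \<Gamma>) 0" using f[of "F e" e] by simp
    show "\<forall>m<F e. \<exists>y>0. eval f (m # map (\<lambda>g. g e) \<Gamma>) y"
      using f[of _ e] by (metis (full_types) less_irrefl zero_less_one)
  qed
  then show ?thesis unfolding recursive_in_def by blast
qed

lemmas recursive_intros =
  recursive_in_const recursive_in_Suc recursive_in_add recursive_in_if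
  decidable_in_const decidable_in_not decidable_in_and decidable_in_or decidable_in_imp decidable_in_iff
  decidable_in_eq decidable_in_le decidable_in_less decidable_in_ex_less decidable_in_all_less

section \<open>Codes of pairs and lists\<close>

lemma recursive_in_prod_encode:
  assumes "recursive_in \<Gamma> x" "recursive_in \<Gamma> y"
  shows "recursive_in \<Gamma> (\<lambda>e. prod_encode (x e, y e))"
proof -
  \<comment> \<open>Cantor pairing is a triangular number plus the first component.\<close>
  have "rec_nat 0 (\<lambda>n y. Suc (y + n)) k = triangle k" for k by (induction k) auto
  then have eq: "(\<lambda>e. prod_encode (x e, y e)) =
      (\<lambda>e. rec_nat 0 (\<lambda>n y. Suc (y + n)) (x e + y e) + x e)"
    by (simp add: prod_encode_def)
  show ?thesis unfolding eq
    by (intro recursive_in_rec_nat recursive_intros assms) (simp_all add: recursive_in_var)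
qed

lemma recursive_in_fst_prod_decode:
  assumes "recursive_in \<Gamma> x"
  shows "recursive_in \<Gamma> (\<lambda>e. fst (prod_decode (x e)))"
proof -
  \<comment> \<open>The other component never exceeds the code, which bounds the search for
    it.\<close>
  have eq: "fst (prod_decode n) = y \<longleftrightarrow> (\<exists>i<Suc n. prod_encode (y, i) = n)" for n y
  proof
    assume "fst (prod_decode n) = y"
    then have "prod_encode (y, snd (prod_decode n)) = n" by auto
    then show "\<exists>i<Suc n. prod_encode (y, i) = n"
      by (metis le_imp_less_Suc le_prod_encode_2)
  qed auto
  have "recursive_in [\<lambda>n. n] (\<lambda>n. fst (prod_decode n))"
    by (rule recursive_in_graph, unfold eq, intro recursive_intros recursive_in_prod_encode)
      (simp_all add: recursive_in_var)
  from recursive_in_compose[OF this, of \<Gamma> x] assms show ?thesis by simp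
qed

lemma recursive_in_snd_prod_decode:
  assumes "recursive_in \<Gamma> x"
  shows "recursive_in \<Gamma> (\<lambda>e. snd (prod_decode (x e)))"
proof -
  have eq: "snd (prod_decode n) = y \<longleftrightarrow> prod_encode (fst (prod_decode n), y) = n" for n y
    by (metis prod.collapse prod_decode_inverse prod_encode_inverse snd_conv)
  have "recursive_in [\<lambda>n. n] (\<lambda>n. snd (prod_decode n))"
    by (rule recursive_in_graph, unfold eq,
        intro recursive_intros recursive_in_prod_encode recursive_in_fst_prod_decode)
      (simp_all add: recursive_in_var)
  from recursive_in_compose[OF this, of \<Gamma> x] assms show ?thesis by simp
qed

text \<open>The basic operation on list codes: length and entries are computed from it, and
  membership and mapping from those two.\<close>

definition code_drop :: "nat \<Rightarrow> nat \<Rightarrow> nat" where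
  "code_drop c i = list_encode (drop i (list_decode c))"

text \<open>With the default 0 every number codes a total map on letters, so a search over maps
  becomes a search over numbers.\<close>

definition code_nth :: "nat \<Rightarrow> nat \<Rightarrow> nat" where
  "code_nth c i = (if i < length (list_decode c) then list_decode c ! i else 0)"

lemma recursive_in_code_drop:
  assumes "recursive_in \<Gamma> x" "recursive_in \<Gamma> y"
  shows "recursive_in \<Gamma> (\<lambda>e. code_drop (x e) (y e))"
proof -
  \<comment> \<open>Code 0 is the empty list; a nonempty list has the successor of the pair code of
    its head and the code of its tail.\<close>
  have tl: "list_encode (tl (list_decode c)) = (if c = 0 then 0 else snd (prod_decode (c - 1)))" for c
    by (cases c) (auto split: prod.split)
  have "rec_nat c (\<lambda>_ d. if d = 0 then 0 else snd (prod_decode (d - 1))) i = code_drop c i" for c i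
  proof (induction i)
    case (Suc i)
    have "list_encode (drop (Suc i) (list_decode c)) = list_encode (tl (list_decode (code_drop c i)))"
      by (simp add: code_drop_def drop_Suc tl_drop)
    then show ?case using Suc unfolding tl by (simp add: code_drop_def)
  qed (simp add: code_drop_def)
  then have eq: "(\<lambda>e. code_drop (x e) (y e)) =
      (\<lambda>e. rec_nat (x e) (\<lambda>_ d. if d = 0 then 0 else snd (prod_decode (d - 1))) (y e))" by simp
  show ?thesis unfolding eq
    by (intro recursive_in_rec_nat recursive_in_snd_prod_decode recursive_in_pred recursive_intros assms)
      (simp_all add: recursive_in_var)
qed

lemma code_drop_eq_0_iff: "code_drop c i = 0 \<longleftrightarrow> length (list_decode c) \<le> i"
proof -
  have "list_encode xs = 0 \<longleftrightarrow> xs = []" for xs by (cases xs) auto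
  then show ?thesis by (simp add: code_drop_def)
qed

lemma recursive_in_length_list_decode:
  assumes "recursive_in \<Gamma> x"
  shows "recursive_in \<Gamma> (\<lambda>e. length (list_decode (x e)))"
proof -
  \<comment> \<open>The length is the least number of entries whose removal leaves the empty list,
    whose code is 0.\<close>
  have eq: "length (list_decode c) = y \<longleftrightarrow> code_drop c y = 0 \<and> (\<forall>i<y. \<not> code_drop c i = 0)" for c y
    unfolding code_drop_eq_0_iff by (auto simp: not_le intro: antisym) (meson le_less_linear less_irrefl antisym)
  have "recursive_in [\<lambda>n. n] (\<lambda>n. length (list_decode n))"
    by (rule recursive_in_graph, unfold eq, intro recursive_intros recursive_in_code_drop)
      (simp_all add: recursive_in_var)
  from recursive_in_compose[OF this, of \<Gamma> x] assms show ?thesis by simp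
qed

lemma recursive_in_code_nth:
  assumes "recursive_in \<Gamma> x" "recursive_in \<Gamma> y"
  shows "recursive_in \<Gamma> (\<lambda>e. code_nth (x e) (y e))"
proof -
  have "code_nth c i = (if code_drop c i = 0 then 0 else fst (prod_decode (code_drop c i - 1)))" for c i
  proof (cases "i < length (list_decode c)")
    case True
    then have "code_drop c i = Suc (prod_encode (list_decode c ! i, list_encode (drop (Suc i) (list_decode c))))"
      by (simp add: code_drop_def flip: Cons_nth_drop_Suc)
    then show ?thesis using True by (simp add: code_nth_def)
  qed (simp add: code_nth_def code_drop_eq_0_iff)
  then show ?thesis
    by (simp only:) (intro recursive_intros recursive_in_fst_prod_decode recursive_in_pred
        recursive_in_code_drop assms)
qed

lemma decidable_in_mem_list_decode:
  assumes "recursive_in \<Gamma> x" "recursive_in \<Gamma> y"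
  shows "decidable_in \<Gamma> (\<lambda>e. x e \<in> set (list_decode (y e)))"
proof -
  have eq: "a \<in> set (list_decode c) \<longleftrightarrow> (\<exists>i<length (list_decode c). code_nth c i = a)" for a c
    by (auto simp: code_nth_def in_set_conv_nth)
  have "decidable_in [fst, snd] (\<lambda>p. fst p \<in> set (list_decode (snd p)))"
    unfolding eq by (intro recursive_intros recursive_in_code_nth recursive_in_length_list_decode)
      (simp_all add: recursive_in_var)
  from decidable_in_compose[OF this, of \<Gamma> "\<lambda>e. (x e, y e)"] assms show ?thesis by simp
qed

text \<open>Length and entries determine the image, which gives a decidable graph.\<close>

lemma recursive_in_map_code_nth:
  assumes "recursive_in \<Gamma> x" "recursive_in \<Gamma> y"
  shows "recursive_in \<Gamma> (\<lambda>e. list_encode (map (code_nth (x e)) (list_decode (y e))))"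
proof -
  have eq: "list_encode (map (code_nth s) (list_decode w)) = y \<longleftrightarrow>
      length (list_decode y) = length (list_decode w) \<and>
      (\<forall>i<length (list_decode w). code_nth y i = code_nth s (code_nth w i))" for s w y
  proof -
    have "list_encode (map (code_nth s) (list_decode w)) = y \<longleftrightarrow>
        map (code_nth s) (list_decode w) = list_decode y"
      by (metis list_decode_inverse list_encode_inverse)
    also have "\<dots> \<longleftrightarrow> length (list_decode y) = length (list_decode w) \<and>
      (\<forall>i<length (list_decode w). list_decode y ! i = code_nth s (list_decode w ! i))"
      by (auto simp: list_eq_iff_nth_eq)
    finally show ?thesis by (auto simp: code_nth_def)
  qed
  have "recursive_in [fst, snd] (\<lambda>p. list_encode (map (code_nth (fst p)) (list_decode (snd p))))"
    by (rule recursive_in_graph, unfold eq,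
        intro recursive_intros recursive_in_code_nth recursive_in_length_list_decode)
      (simp_all add: recursive_in_var)
  from recursive_in_compose[OF this, of \<Gamma> "\<lambda>e. (x e, y e)"] assms show ?thesis by simp
qed

text \<open>The code of the list of \<open>k\<close> entries equal to \<open>m\<close>, which by
  monotonicity of the coding dominates all shorter lists with smaller entries.\<close>

definition list_bound :: "nat \<Rightarrow> nat \<Rightarrow> nat" where
  "list_bound m k = rec_nat 0 (\<lambda>_ c. Suc (prod_encode (m, c))) k"

lemma recursive_in_list_bound:
  assumes "recursive_in \<Gamma> x" "recursive_in \<Gamma> y"
  shows "recursive_in \<Gamma> (\<lambda>e. list_bound (x e) (y e))"
proof -
  have "recursive_in [fst, snd] (\<lambda>p. list_bound (fst p) (snd p))"
    unfolding list_bound_def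
    by (intro recursive_in_rec_nat recursive_intros recursive_in_prod_encode)
      (simp_all add: recursive_in_var)
  from recursive_in_compose[OF this, of \<Gamma> "\<lambda>e. (x e, y e)"] assms show ?thesis by simp
qed

lemma prod_encode_mono: "a \<le> c \<Longrightarrow> b \<le> d \<Longrightarrow> prod_encode (a, b) \<le> prod_encode (c, d)"
  unfolding prod_encode_def triangle_def
  by (auto intro!: add_mono div_le_mono mult_le_mono)

lemma list_encode_le_list_bound:
  "set xs \<subseteq> {..m} \<Longrightarrow> length xs \<le> k \<Longrightarrow> list_encode xs \<le> list_bound m k"
proof (induction xs arbitrary: k)
  case (Cons x xs)
  then obtain j where "k = Suc j" "length xs \<le> j" by (cases k) auto
  with Cons show ?case by (auto simp: list_bound_def intro!: prod_encode_mono)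
qed simp

lemma elem_less_list_encode: "x \<in> set xs \<Longrightarrow> x < list_encode xs"
proof (induction xs)
  case (Cons a xs)
  have "a \<le> prod_encode (a, list_encode xs)" "list_encode xs \<le> prod_encode (a, list_encode xs)"
    by (rule le_prod_encode_1, rule le_prod_encode_2)
  then show ?case using Cons by auto
qed simp

section \<open>Monoids with C(2) presentations\<close>

text \<open>Unlike in \<open>pcong\<close>, relations are applied to whole words only.\<close>

definition conn :: "presentation \<Rightarrow> (word \<times> word) set" where
  "conn P = (rels P \<union> (rels P)\<inverse>)\<^sup>*"

text \<open>The indecomposable letters, with the least letter representing its component.\<close>

definition canonical :: "presentation \<Rightarrow> nat \<Rightarrow> bool" where
  "canonical P a \<longleftrightarrow> a < fst P \<and> (\<forall>w. ([a], w) \<in> conn P \<longrightarrow> length w < 2) \<and>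
     (\<forall>b<a. ([b], [a]) \<notin> conn P)"

text \<open>Half of the combinatorial criterion for isomorphism; the other half exchanges the
  presentations and the two maps. Components enter only through their long words, since normal forms
  absorb the relations that identify letters.\<close>

definition transfers :: "(nat \<Rightarrow> nat) \<Rightarrow> (nat \<Rightarrow> nat) \<Rightarrow> presentation \<Rightarrow> presentation \<Rightarrow> bool" where
  "transfers s t P Q \<longleftrightarrow>
     (\<forall>a. canonical P a \<longrightarrow> canonical Q (s a) \<and> t (s a) = a) \<and>
     (\<forall>l r. (l, r) \<in> conn P \<longrightarrow> 2 \<le> length l \<longrightarrow> 2 \<le> length r \<longrightarrow> (map s l, map s r) \<in> conn Q)"

lemma conn_refl [simp]: "(w, w) \<in> conn P"
  by (simp add: conn_def)

lemma conn_sym: "(u, v) \<in> conn P \<Longrightarrow> (v, u) \<in> conn P"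
  unfolding conn_def by (metis converse_Un converse_converse converse_iff rtrancl_converse sup_commute)

lemma conn_trans: "(u, v) \<in> conn P \<Longrightarrow> (v, w) \<in> conn P \<Longrightarrow> (u, w) \<in> conn P"
  unfolding conn_def by simp

lemma conn_rel: "(l, r) \<in> rels P \<Longrightarrow> (l, r) \<in> conn P"
  unfolding conn_def by blast

text \<open>A nontrivial path ends with an edge, whose endpoint is a side of a relation; symmetry
  handles the start.\<close>

lemma conn_relation_word:
  assumes "(u, v) \<in> conn P" "u \<noteq> v"
  shows "u \<in> relation_words P" "v \<in> relation_words P"
proof -
  have "v \<in> relation_words P" if "(u, v) \<in> conn P" "u \<noteq> v" for u v
    using that unfolding conn_def
    by (cases rule: rtranclE) (force simp: relation_words_def)+
  then show "u \<in> relation_words P" "v \<in> relation_words P" using assms conn_sym by metis+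
qed

lemma append_in_words [simp]: "u @ v \<in> words P \<longleftrightarrow> u \<in> words P \<and> v \<in> words P"
  by (auto simp: words_def)

lemma Nil_in_words [simp]: "[] \<in> words P"
  by (simp add: words_def)

lemma Cons_in_words: "a # w \<in> words P \<longleftrightarrow> a < fst P \<and> w \<in> words P"
  by (auto simp: words_def alph_def)

lemma canonical_word_in_words: "\<forall>a\<in>set w. canonical P a \<Longrightarrow> w \<in> words P"
  by (auto simp: words_def alph_def canonical_def)

lemma canonical_unique:
  "canonical P a \<Longrightarrow> canonical P b \<Longrightarrow> ([a], [b]) \<in> conn P \<Longrightarrow> a = b"
  using conn_sym unfolding canonical_def by (metis nat_neq_iff)

section \<open>The congruence of a well-formed presentation\<close>

locale wf_presentation =
  fixes P :: presentation
  assumes wf: "well_formed P"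
begin

lemma relation_words_in_words: "w \<in> relation_words P \<Longrightarrow> w \<in> words P"
  using wf by (auto simp: relation_words_def well_formed_def)

lemma rels_in_words: "(l, r) \<in> rels P \<Longrightarrow> l \<in> words P \<and> r \<in> words P"
  using wf by (auto simp: well_formed_def)

lemma conn_in_words: "(u, v) \<in> conn P \<Longrightarrow> u \<in> words P \<Longrightarrow> v \<in> words P"
  using conn_relation_word relation_words_in_words by metis

lemma pcong_in_words: "pcong P u v \<Longrightarrow> u \<in> words P \<and> v \<in> words P"
  by (induction rule: pcong.induct) (auto dest: rels_in_words)

lemma pcong_context:
  "pcong P u v \<Longrightarrow> x \<in> words P \<Longrightarrow> y \<in> words P \<Longrightarrow> pcong P (x @ u @ y) (x @ v @ y)"
proof (induction rule: pcong.induct)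
  case (rel l r u v)
  then show ?case using pcong.rel[of l r P "x @ u" "v @ y"] by simp
qed (auto intro: pcong.refl pcong.sym pcong.trans)

lemma pcong_append:
  assumes "pcong P u u'" "pcong P v v'"
  shows "pcong P (u @ v) (u' @ v')"
proof -
  have "pcong P (u @ v) (u' @ v)"
    using pcong_context[OF assms(1), of "[]" v] pcong_in_words[OF assms(2)] by simp
  moreover have "pcong P (u' @ v) (u' @ v')"
    using pcong_context[OF assms(2), of u' "[]"] pcong_in_words[OF assms(1)] by simp
  ultimately show ?thesis by (rule pcong.trans)
qed

lemma conn_pcong:
  assumes "(u, v) \<in> conn P" "u \<in> words P"
  shows "pcong P u v"
  using assms(1) unfolding conn_def
proof (induction rule: rtrancl_induct)
  case base
  then show ?case using assms(2) by (rule pcong.refl)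
next
  case (step y z)
  then have "pcong P y z"
    using pcong.rel[of y z P "[]" "[]"] pcong.sym[OF pcong.rel[of z y P "[]" "[]"]] by auto
  then show ?case using step.IH pcong.trans by blast
qed

end

section \<open>Relation words under C(2)\<close>

locale C2_presentation = wf_presentation +
  assumes C2: "C2 P"
begin

lemma relation_word_not_Nil: "[] \<notin> relation_words P"
proof
  assume "[] \<in> relation_words P"
  \<comment> \<open>The empty word is the product of zero pieces.\<close>
  then show False using C2 unfolding small_overlap_def
    by (auto dest!: bspec spec[of _ "[]"])
qed

text \<open>A relation word lying properly inside another one is a piece, so it would be a product
  of one piece.\<close>

lemma relation_word_factor:
  assumes w: "x @ w @ y \<in> relation_words P" "w \<in> relation_words P"
  shows "x = []" "y = []"
proof -
  have "w = x @ w @ y"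
  proof (rule ccontr)
    assume "w \<noteq> x @ w @ y"
    moreover have "occurs_at w w 0" "occurs_at w (x @ w @ y) (length x)"
      by (auto simp: occurs_at_def)
    ultimately have "piece P w" using w unfolding piece_def is_factor_def by blast
    then have "length [w] < 2 \<and> (\<forall>p\<in>set [w]. piece P p) \<and> concat [w] = w" by simp
    then show False using C2 w(2) unfolding small_overlap_def by blast
  qed
  then have "length w = length (x @ w @ y)" by metis
  then show "x = []" "y = []" by simp_all
qed

text \<open>Such a letter is a proper factor of a relation word, hence no relation word itself, so
  its component is a singleton.\<close>

lemma long_relation_word_canonical:
  assumes "w \<in> relation_words P" "2 \<le> length w" "a \<in> set w"
  shows "canonical P a"
proof -
  obtain x y where xy: "w = x @ [a] @ y" using assms(3) by (auto dest: split_list)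
  have "[a] \<notin> relation_words P"
    using relation_word_factor[of x "[a]" y] assms xy by auto
  then have "([a], v) \<in> conn P \<Longrightarrow> v = [a]" "(v, [a]) \<in> conn P \<Longrightarrow> v = [a]" for v
    using conn_relation_word by metis+
  then show ?thesis
    using relation_words_in_words[OF assms(1)] xy
    by (force simp: canonical_def Cons_in_words)
qed

text \<open>Such a word \<open>u\<close> can only be rewritten as a whole.\<close>

lemma pcong_conn:
  assumes "pcong P u v" "u \<in> relation_words P \<or> length u < 2"
  shows "(u, v) \<in> conn P"
proof -
  let ?X = "\<lambda>w. w \<in> relation_words P \<or> length w < 2"
  \<comment> \<open>Allowing the condition at either end makes the claim symmetric; for
    transitivity, \<open>conn\<close> carries the condition to the middle word.\<close>
  have "?X x \<or> ?X y \<Longrightarrow> (x, y) \<in> conn P" if "pcong P x y" for x y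
    using that
  proof (induction rule: pcong.induct)
    case (rel l r u v)
    \<comment> \<open>A relation word fills a relation word containing it by C(2), and fills a word
      of length at most one because it is nonempty.\<close>
    have whole: "u = [] \<and> v = []" if "?X (u @ w @ v)" "w \<in> relation_words P" for w
      using that relation_word_factor[of u w v] relation_word_not_Nil by (cases w) auto
    have "l \<in> relation_words P" "r \<in> relation_words P"
      using rel by (force simp: relation_words_def)+
    then have "u = [] \<and> v = []" using rel.prems whole by blast
    then show ?case using rel conn_rel by simp
  next
    case (trans x y z)
    have "?X a \<Longrightarrow> (a, b) \<in> conn P \<Longrightarrow> ?X b" for a b using conn_relation_word by metis
    then show ?case using trans conn_trans conn_sym by metis
  qed (auto intro: conn_sym)
  then show ?thesis using assms by blast
qed

lemma pcong_Nil: "pcong P [] w \<Longrightarrow> w = []"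
  using pcong_conn[of "[]" w] conn_relation_word[of "[]" w P] relation_word_not_Nil by auto

text \<open>By \<open>pcong_conn\<close> the class of the letter is its component, whose words are
  short; the empty word is alone in its class.\<close>

lemma canonical_pcong_length:
  assumes "canonical P a" "pcong P [a] w"
  shows "length w = 1"
proof -
  have "length w < 2" using assms pcong_conn[of "[a]" w] by (simp add: canonical_def)
  moreover have "w \<noteq> []" using assms(2) pcong_Nil[of "[a]"] pcong.sym by blast
  ultimately show ?thesis by (cases w) auto
qed

section \<open>Normal forms in canonical letters\<close>

definition least_rep :: "nat \<Rightarrow> nat" where
  "least_rep a = (LEAST b. ([b], [a]) \<in> conn P)"

lemma least_rep_conn: "([least_rep a], [a]) \<in> conn P"
  unfolding least_rep_def by (rule LeastI[of _ a]) simp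

lemma canonical_least_rep:
  assumes "a < fst P" and short: "\<And>w. ([a], w) \<in> conn P \<Longrightarrow> length w < 2"
  shows "canonical P (least_rep a)"
proof -
  have "[least_rep a] \<in> words P"
    using conn_in_words[OF conn_sym[OF least_rep_conn], of a] assms(1) by (simp add: Cons_in_words)
  moreover have "length w < 2" if "([least_rep a], w) \<in> conn P" for w
    using that short least_rep_conn conn_sym conn_trans by metis
  moreover have "([b], [least_rep a]) \<notin> conn P" if "b < least_rep a" for b
    using that not_less_Least[of b "\<lambda>b. ([b], [a]) \<in> conn P"] conn_trans[OF _ least_rep_conn]
    unfolding least_rep_def by blast
  ultimately show ?thesis by (simp add: canonical_def Cons_in_words)
qed

text \<open>A decomposable letter is expanded into a long relation word of its component. The
  letters of that word are already canonical, so a single pass suffices.\<close>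

definition nf_letter :: "nat \<Rightarrow> word" where
  "nf_letter a = (if \<exists>w. ([a], w) \<in> conn P \<and> 2 \<le> length w
     then SOME w. ([a], w) \<in> conn P \<and> 2 \<le> length w else [least_rep a])"

text \<open>Congruent words can still differ here: distinct long relation words of one component are
  their own normal forms.\<close>

definition nf :: "word \<Rightarrow> word" where
  "nf w = concat (map nf_letter w)"

lemma nf_Nil [simp]: "nf [] = []" and nf_append [simp]: "nf (u @ v) = nf u @ nf v"
  by (simp_all add: nf_def)

lemma nf_letter_conn: "([a], nf_letter a) \<in> conn P"
proof (cases "\<exists>w. ([a], w) \<in> conn P \<and> 2 \<le> length w")
  case True
  from someI_ex[OF this] True show ?thesis by (simp add: nf_letter_def)
next
  case False
  then have "nf_letter a = [least_rep a]" unfolding nf_letter_def by (rule if_not_P)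
  then show ?thesis by (simp add: least_rep_conn conn_sym)
qed

lemma nf_letter_canonical:
  assumes "a < fst P" "b \<in> set (nf_letter a)"
  shows "canonical P b"
proof (cases "\<exists>w. ([a], w) \<in> conn P \<and> 2 \<le> length w")
  case True
  from someI_ex[OF this] True have long: "2 \<le> length (nf_letter a)" by (simp add: nf_letter_def)
  then have "[a] \<noteq> nf_letter a" by (auto dest: arg_cong[of _ _ length])
  then have "nf_letter a \<in> relation_words P"
    by (rule conn_relation_word(2)[OF nf_letter_conn])
  then show ?thesis using long assms long_relation_word_canonical by blast
next
  case False
  then have "nf_letter a = [least_rep a]" unfolding nf_letter_def by (rule if_not_P)
  moreover have "canonical P (least_rep a)"
    using False by (intro canonical_least_rep[OF assms(1)]) (auto simp: not_le)
  ultimately show ?thesis using assms(2) by simp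
qed

lemma nf_canonical: "w \<in> words P \<Longrightarrow> b \<in> set (nf w) \<Longrightarrow> canonical P b"
  by (auto simp: nf_def words_def alph_def subset_iff dest: nf_letter_canonical)

lemma nf_canonical_word: "\<forall>a\<in>set w. canonical P a \<Longrightarrow> nf w = w"
proof (induction w)
  case (Cons a w)
  then have a: "canonical P a" by simp
  have "nf_letter a = [least_rep a]"
    using a by (auto simp: nf_letter_def canonical_def not_le[symmetric])
  moreover have "least_rep a = a"
    using canonical_unique[OF canonical_least_rep a least_rep_conn] a by (auto simp: canonical_def)
  ultimately show ?case using Cons by (simp add: nf_def)
qed simp

lemma nf_pcong: "w \<in> words P \<Longrightarrow> pcong P w (nf w)"
proof (induction w)
  case (Cons a w)
  have "pcong P [a] (nf_letter a)"
    using Cons by (intro conn_pcong nf_letter_conn) (simp add: Cons_in_words)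
  then have "pcong P ([a] @ w) (nf_letter a @ nf w)"
    using Cons by (intro pcong_append) (simp_all add: Cons_in_words)
  then show ?case by (simp add: nf_def)
qed (simp add: pcong.refl)

text \<open>Each side is connected to its normal form, so the normal forms are connected. If one is
  a single canonical letter, its component contains no other canonical word; thus only connections
  between long words survive.\<close>

lemma nf_rel:
  assumes "(l, r) \<in> rels P"
  shows "nf l = nf r \<or> 2 \<le> length (nf l) \<and> 2 \<le> length (nf r) \<and> (nf l, nf r) \<in> conn P"
proof -
  have lr: "l \<in> relation_words P" "r \<in> relation_words P"
    using assms by (force simp: relation_words_def)+
  have "(w, nf w) \<in> conn P" if w: "w \<in> relation_words P" for w
  proof (cases "2 \<le> length w")
    case True
    then show ?thesis using w long_relation_word_canonical nf_canonical_word by simp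
  next
    case False
    then obtain a where "w = [a]"
      using w relation_word_not_Nil by (cases w) (auto simp: not_less_eq_eq[symmetric])
    then show ?thesis using nf_letter_conn by (simp add: nf_def)
  qed
  then have conn: "(nf l, nf r) \<in> conn P"
    using lr conn_rel[OF assms] conn_sym conn_trans by metis
  \<comment> \<open>Applied in both orders below, this excludes a short word among two distinct
    connected canonical words.\<close>
  have "x = y \<or> 2 \<le> length y"
    if x: "\<forall>a\<in>set x. canonical P a" and y: "\<forall>a\<in>set y. canonical P a"
      and xy: "(x, y) \<in> conn P" "\<not> 2 \<le> length x \<or> \<not> 2 \<le> length y" for x y
  proof (rule ccontr)
    assume "\<not> ?thesis"
    then have "x \<noteq> y" "length y < 2" by auto
    then have "y \<noteq> []" using relation_word_not_Nil conn_relation_word(2) xy(1) by metis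
    then obtain b where b: "y = [b]" using \<open>length y < 2\<close> by (cases y) auto
    then have "length x < 2" using y conn_sym[OF xy(1)] by (auto simp: canonical_def)
    moreover have "x \<noteq> []" using relation_word_not_Nil conn_relation_word(1) xy(1) \<open>x \<noteq> y\<close> by metis
    ultimately obtain a where "x = [a]" by (cases x) auto
    then show False using canonical_unique x y xy(1) b \<open>x \<noteq> y\<close> by auto
  qed
  from this[of "nf l" "nf r"] this[of "nf r" "nf l"] show ?thesis
    using conn conn_sym nf_canonical rels_in_words[OF assms] by metis
qed

text \<open>The first rewriting step that changes the normal form exhibits a long relation word in it.\<close>

lemma nf_change:
  assumes "pcong P u v" "nf u \<noteq> nf v"
  shows "\<exists>x l y r. nf u = x @ l @ y \<and> (l, r) \<in> conn P \<and> l \<noteq> r \<and> 2 \<le> length l \<and> 2 \<le> length r"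
proof -
  let ?X = "\<lambda>w. \<exists>x l y r. w = x @ l @ y \<and> (l, r) \<in> conn P \<and> l \<noteq> r \<and> 2 \<le> length l \<and> 2 \<le> length r"
  \<comment> \<open>Claiming the factor at both ends makes the symmetric and transitive cases
    immediate.\<close>
  have "nf u = nf v \<or> ?X (nf u) \<and> ?X (nf v)"
    using assms(1)
  proof (induction rule: pcong.induct)
    case (rel l r u v)
    show ?case
    proof (cases "nf l = nf r")
      case False
      then have *: "2 \<le> length (nf l)" "2 \<le> length (nf r)" "(nf l, nf r) \<in> conn P" "(nf r, nf l) \<in> conn P"
        using nf_rel[OF rel(1)] conn_sym by auto
      have "?X (nf (u @ l @ v))"
        using * False by (intro exI[of _ "nf u"] exI[of _ "nf l"] exI[of _ "nf v"] exI[of _ "nf r"]) simp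
      moreover have "?X (nf (u @ r @ v))"
        using * False by (intro exI[of _ "nf u"] exI[of _ "nf r"] exI[of _ "nf v"] exI[of _ "nf l"]) simp
      ultimately show ?thesis by blast
    qed simp
  next
    case (trans u v w)
    then show ?case by metis
  qed auto
  then show ?thesis using assms(2) by blast
qed

end

section \<open>Isomorphisms as mutually inverse homomorphisms\<close>

text \<open>A monoid homomorphism between the quotients, given on representatives.\<close>

definition cong_hom :: "presentation \<Rightarrow> presentation \<Rightarrow> (word \<Rightarrow> word) \<Rightarrow> bool" where
  "cong_hom P Q h \<longleftrightarrow> (\<forall>u\<in>words P. h u \<in> words Q) \<and>
     (\<forall>u v. pcong P u v \<longrightarrow> pcong Q (h u) (h v)) \<and>
     (\<forall>u\<in>words P. \<forall>v\<in>words P. pcong Q (h (u @ v)) (h u @ h v)) \<and> pcong Q (h []) []"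

text \<open>This symmetric form lets each later argument be repeated with the presentations
  exchanged.\<close>

lemma presented_iso_iff_inverse_homs:
  assumes "well_formed P" "well_formed Q"
  shows "presented_iso P Q \<longleftrightarrow> (\<exists>h k. cong_hom P Q h \<and> cong_hom Q P k \<and>
     (\<forall>u\<in>words P. pcong P (k (h u)) u) \<and> (\<forall>w\<in>words Q. pcong Q (h (k w)) w))"
    (is "_ \<longleftrightarrow> ?R")
proof -
  interpret P: wf_presentation P using assms by unfold_locales
  interpret Q: wf_presentation Q using assms by unfold_locales
  show ?thesis
  proof
    assume "presented_iso P Q"
    then obtain h where h: "\<And>u. u \<in> words P \<Longrightarrow> h u \<in> words Q"
      "\<And>u v. u \<in> words P \<Longrightarrow> v \<in> words P \<Longrightarrow> pcong P u v \<longleftrightarrow> pcong Q (h u) (h v)"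
      "\<And>w. w \<in> words Q \<Longrightarrow> \<exists>u\<in>words P. pcong Q (h u) w"
      "\<And>u v. u \<in> words P \<Longrightarrow> v \<in> words P \<Longrightarrow> pcong Q (h (u @ v)) (h u @ h v)"
      "pcong Q (h []) []"
      unfolding presented_iso_def by blast
    \<comment> \<open>\<open>k\<close> chooses preimages; its properties follow because
      \<open>h\<close> reflects congruence.\<close>
    obtain k where k: "\<And>w. w \<in> words Q \<Longrightarrow> k w \<in> words P \<and> pcong Q (h (k w)) w"
      using h(3) by metis
    have "pcong P (k u) (k v)" if "pcong Q u v" for u v
      using that h(2)[of "k u" "k v"] k[of u] k[of v] Q.pcong_in_words[OF that]
      by (blast intro: pcong.trans pcong.sym)
    moreover have "pcong P (k (u @ v)) (k u @ k v)" if "u \<in> words Q" "v \<in> words Q" for u v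
    proof -
      have "pcong Q (h (k u @ k v)) (u @ v)"
        using that k[of u] k[of v] h(4)[of "k u" "k v"] Q.pcong_append
        by (blast intro: pcong.trans)
      then have "pcong Q (h (k (u @ v))) (h (k u @ k v))"
        using that k[of "u @ v"] by (auto intro: pcong.trans pcong.sym)
      then show ?thesis using that k h(2)[of "k (u @ v)" "k u @ k v"] by simp
    qed
    moreover have "pcong P (k []) []"
      using h(2)[of "k []" "[]"] k[of "[]"] h(5) by (auto intro: pcong.trans pcong.sym)
    moreover have "pcong P (k (h u)) u" if "u \<in> words P" for u
      using that h(2)[of "k (h u)" u] k[of "h u"] h(1) by blast
    moreover have "pcong Q (h u) (h v)" if "pcong P u v" for u v
      using that P.pcong_in_words h(2) by blast
    ultimately show ?R
      unfolding cong_hom_def using h(1,4,5) k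
      by (intro exI[of _ h] exI[of _ k]) auto
  next
    assume ?R
    then obtain h k where h: "cong_hom P Q h" and k: "cong_hom Q P k"
      and kh: "\<And>u. u \<in> words P \<Longrightarrow> pcong P (k (h u)) u"
      and hk: "\<And>w. w \<in> words Q \<Longrightarrow> pcong Q (h (k w)) w" by blast
    have "pcong P u v" if "u \<in> words P" "v \<in> words P" "pcong Q (h u) (h v)" for u v
    proof -
      have "pcong P (k (h u)) (k (h v))" using k that unfolding cong_hom_def by blast
      then show ?thesis using kh that by (blast intro: pcong.trans pcong.sym)
    qed
    moreover have "\<exists>u\<in>words P. pcong Q (h u) w" if "w \<in> words Q" for w
      using hk[OF that] k that unfolding cong_hom_def by blast
    ultimately show "presented_iso P Q"
      unfolding presented_iso_def using h by (intro exI[of _ h]) (auto simp: cong_hom_def)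
  qed
qed

section \<open>Letter maps and isomorphisms\<close>

locale C2_presentation_pair = P: C2_presentation P + Q: C2_presentation Q for P Q
begin

lemma transfers_canonical_word:
  assumes "transfers s t P Q" "w \<in> words P"
  shows "\<forall>b\<in>set (map s (P.nf w)). canonical Q b"
  using assms P.nf_canonical unfolding transfers_def by auto

text \<open>Normalise, then rename letters. By \<open>nf_rel\<close> a relation becomes an equality
  or a connection between long words, and \<open>s\<close> respects the latter.\<close>

lemma transfers_cong_hom:
  assumes tr: "transfers s t P Q"
  shows "cong_hom P Q (\<lambda>w. map s (P.nf w))"
proof -
  have words: "map s (P.nf u) \<in> words Q" if "u \<in> words P" for u
    using canonical_word_in_words transfers_canonical_word[OF tr that] by blast
  have "pcong Q (map s (P.nf u)) (map s (P.nf v))" if "pcong P u v" for u v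
    using that
  proof (induction rule: pcong.induct)
    case (refl w)
    then show ?case using words pcong.refl by blast
  next
    case (rel l r u v)
    have "(map s (P.nf l), map s (P.nf r)) \<in> conn Q"
      using P.nf_rel[OF rel(1)] tr unfolding transfers_def by auto
    then have "pcong Q (map s (P.nf l)) (map s (P.nf r))"
      using words P.rels_in_words[OF rel(1)] by (blast intro: Q.conn_pcong)
    then show ?case using Q.pcong_context words rel by simp
  qed (auto intro: pcong.sym pcong.trans)
  then show ?thesis using words by (auto simp: cong_hom_def pcong.refl)
qed

lemma transfers_inverse:
  assumes "transfers s t P Q" "w \<in> words P"
  shows "map t (Q.nf (map s (P.nf w))) = P.nf w"
proof -
  have "Q.nf (map s (P.nf w)) = map s (P.nf w)"
    by (rule Q.nf_canonical_word[OF transfers_canonical_word[OF assms]])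
  then show ?thesis
    using assms P.nf_canonical unfolding transfers_def by (auto intro: map_idI)
qed

text \<open>A canonical letter is indecomposable, so its image under an isomorphism is a letter.\<close>

lemma iso_canonical_letter:
  assumes h: "cong_hom P Q h" and k: "cong_hom Q P k"
    and kh: "\<And>u. u \<in> words P \<Longrightarrow> pcong P (k (h u)) u"
    and hk: "\<And>w. w \<in> words Q \<Longrightarrow> pcong Q (h (k w)) w"
    and a: "canonical P a"
  shows "\<exists>b. canonical Q b \<and> pcong Q (h [a]) [b]"
proof -
  have aw: "[a] \<in> words P" using a by (simp add: canonical_def Cons_in_words)
  \<comment> \<open>Applying \<open>h\<close> shows that \<open>w\<close> is congruent to the empty
    word, which is alone in its class.\<close>
  have Nil: "w = []" if "w \<in> words Q" "k w = []" for w
  proof -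
    have "pcong Q (h []) w" using hk[OF that(1)] that(2) by simp
    then have "pcong Q [] w" using h unfolding cong_hom_def by (blast intro: pcong.trans pcong.sym)
    then show ?thesis by (rule Q.pcong_Nil)
  qed
  \<comment> \<open>The images under \<open>k\<close> of the first letter and of the remainder of
    \<open>w\<close> multiply to a word congruent to \<open>[a]\<close>, hence of length 1. So one
    image is empty, and by \<open>Nil\<close> it is that of the remainder.\<close>
  have len: "length w = 1" if w: "pcong Q (h [a]) w" for w
  proof -
    have "w \<in> words Q" using Q.pcong_in_words[OF w] by blast
    have "pcong P (k (h [a])) (k w)" using k w unfolding cong_hom_def by blast
    then have akw: "pcong P [a] (k w)" using kh[OF aw] pcong.sym pcong.trans by blast
    have "w \<noteq> []"
    proof
      assume "w = []"
      then have "pcong P [] [a]"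
        using akw k unfolding cong_hom_def by (blast intro: pcong.trans pcong.sym)
      then show False using P.pcong_Nil by blast
    qed
    then obtain x y where xy: "w = x # y" by (cases w) auto
    then have xyw: "[x] \<in> words Q" "y \<in> words Q"
      using \<open>w \<in> words Q\<close> by (simp_all add: Cons_in_words)
    then have "pcong P (k ([x] @ y)) (k [x] @ k y)" using k unfolding cong_hom_def by blast
    then have "length (k [x] @ k y) = 1"
      using akw xy P.canonical_pcong_length[OF a] pcong.trans by (metis append_Cons append_Nil)
    then have "k [x] = [] \<or> k y = []" by (cases "k [x]"; cases "k y") auto
    then show ?thesis using Nil xyw xy by auto
  qed
  have "pcong Q (h [a]) (h [a])" using h aw unfolding cong_hom_def by (blast intro: pcong.refl)
  then obtain b where b: "h [a] = [b]" using len[of "h [a]"] by (auto simp: length_Suc_conv)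
  then have bw: "[b] \<in> words Q" using h aw unfolding cong_hom_def by metis
  \<comment> \<open>Everything connected to \<open>[b]\<close> is congruent to \<open>h [a]\<close>,
    so \<open>len\<close> applies and the component has a canonical representative.\<close>
  have "length w < 2" if "([b], w) \<in> conn Q" for w
    using len[of w] Q.conn_pcong[OF that bw] b by simp
  then have "canonical Q (Q.least_rep b)"
    using bw by (intro Q.canonical_least_rep) (auto simp: Cons_in_words)
  moreover have "pcong Q [b] [Q.least_rep b]"
    using Q.conn_pcong[OF conn_sym[OF Q.least_rep_conn] bw] .
  ultimately show ?thesis using b by auto
qed

lemma cong_hom_map:
  assumes h: "cong_hom P Q h"
    and s: "\<And>a. canonical P a \<Longrightarrow> canonical Q (s a) \<and> pcong Q (h [a]) [s a]"
  shows "\<forall>a\<in>set w. canonical P a \<Longrightarrow> pcong Q (h w) (map s w)"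
proof (induction w)
  case Nil
  then show ?case using h by (simp add: cong_hom_def)
next
  case (Cons a w)
  then have "[a] \<in> words P" "w \<in> words P" by (auto intro!: canonical_word_in_words)
  then have "pcong Q (h ([a] @ w)) (h [a] @ h w)" using h unfolding cong_hom_def by blast
  moreover have "pcong Q (h [a] @ h w) ([s a] @ map s w)"
    using Cons s by (intro Q.pcong_append) auto
  ultimately show ?case using pcong.trans by fastforce
qed

text \<open>The letters \<open>a\<close> and \<open>t (s a)\<close> are congruent, hence connected,
  and canonical letters represent their components uniquely.\<close>

lemma canonical_letter_inverse:
  assumes h: "cong_hom P Q h" and k: "cong_hom Q P k"
    and kh: "\<And>u. u \<in> words P \<Longrightarrow> pcong P (k (h u)) u"
    and s: "\<And>a. canonical P a \<Longrightarrow> canonical Q (s a) \<and> pcong Q (h [a]) [s a]"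
    and t: "\<And>b. canonical Q b \<Longrightarrow> canonical P (t b) \<and> pcong P (k [b]) [t b]"
    and a: "canonical P a"
  shows "t (s a) = a"
proof -
  have aw: "[a] \<in> words P" using a by (simp add: canonical_def Cons_in_words)
  have "pcong P (k (h [a])) (k [s a])" using k s[OF a] unfolding cong_hom_def by blast
  then have "pcong P [a] [t (s a)]"
    using kh[OF aw] t[of "s a"] s[OF a] by (blast intro: pcong.sym pcong.trans)
  then have "([a], [t (s a)]) \<in> conn P" by (intro P.pcong_conn) auto
  then show ?thesis using canonical_unique[of P a "t (s a)"] a s t by metis
qed

end

lemma iso_transfers:
  assumes "C2_presentation P" "C2_presentation Q"
    and h: "cong_hom P Q h" and k: "cong_hom Q P k"
    and kh: "\<And>u. u \<in> words P \<Longrightarrow> pcong P (k (h u)) u"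
    and hk: "\<And>w. w \<in> words Q \<Longrightarrow> pcong Q (h (k w)) w"
    and s: "\<And>a. canonical P a \<Longrightarrow> canonical Q (s a) \<and> pcong Q (h [a]) [s a]"
    and t: "\<And>b. canonical Q b \<Longrightarrow> canonical P (t b) \<and> pcong P (k [b]) [t b]"
  shows "transfers s t P Q"
proof -
  interpret P: C2_presentation P by fact
  interpret Q: C2_presentation Q by fact
  interpret PQ: C2_presentation_pair P Q ..
  interpret QP: C2_presentation_pair Q P ..
  have ts: "t (s a) = a" if "canonical P a" for a
    by (rule PQ.canonical_letter_inverse[OF h k kh s t that])
  have st: "s (t b) = b" if "canonical Q b" for b
    by (rule QP.canonical_letter_inverse[OF k h hk t s that])
  have "(map s l, map s r) \<in> conn Q"
    if lr: "(l, r) \<in> conn P" "2 \<le> length l" "2 \<le> length r" for l r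
  proof (cases "l = r")
    case False
    have rw: "l \<in> relation_words P" "r \<in> relation_words P"
      using conn_relation_word[OF lr(1) False] by auto
    then have can: "\<forall>a\<in>set l. canonical P a" "\<forall>a\<in>set r. canonical P a"
      using P.long_relation_word_canonical lr by blast+
    have tsw: "map t (map s w) = w" if "\<forall>a\<in>set w. canonical P a" for w
      using that ts by (auto intro: map_idI)
    have "pcong P l r" using P.conn_pcong lr(1) canonical_word_in_words can by blast
    then have "pcong Q (h l) (h r)" using h unfolding cong_hom_def by blast
    then have slr: "pcong Q (map s l) (map s r)"
      using PQ.cong_hom_map[OF h s] can by (blast intro: pcong.sym pcong.trans)
    have can': "\<forall>b\<in>set (map s l). canonical Q b" "\<forall>b\<in>set (map s r). canonical Q b"
      using can s by auto
    \<comment> \<open>The images are distinct, congruent and their own normal forms, so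
      \<open>nf_change\<close> finds a long relation word \<open>u\<close> inside
      \<open>map s l\<close>.\<close>
    have "map s l \<noteq> map s r" using tsw can False by metis
    then obtain x u y v where u: "map s l = x @ u @ y" "(u, v) \<in> conn Q" "u \<noteq> v"
        "2 \<le> length u" "2 \<le> length v"
      using Q.nf_change[OF slr] Q.nf_canonical_word can' by metis
    have uv: "u \<in> relation_words Q" "v \<in> relation_words Q" using conn_relation_word[OF u(2,3)] by auto
    then have canu: "\<forall>b\<in>set u. canonical Q b" "\<forall>b\<in>set v. canonical Q b"
      using Q.long_relation_word_canonical u by blast+
    have "pcong Q u v" using Q.conn_pcong u(2) canonical_word_in_words canu by blast
    then have "pcong P (k u) (k v)" using k unfolding cong_hom_def by blast
    then have tuv: "pcong P (map t u) (map t v)"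
      using QP.cong_hom_map[OF k t] canu by (blast intro: pcong.sym pcong.trans)
    have cantu: "\<forall>a\<in>set (map t u). canonical P a" "\<forall>a\<in>set (map t v). canonical P a"
      using canu t by auto
    have "map s (map t w) = w" if "\<forall>b\<in>set w. canonical Q b" for w
      using that st by (auto intro: map_idI)
    \<comment> \<open>The same argument on the way back finds a relation word \<open>l'\<close>
      inside \<open>map t u\<close>, which is a factor of \<open>l\<close>.\<close>
    then have "map t u \<noteq> map t v" using canu u(3) by metis
    then obtain x' l' y' r' where l': "map t u = x' @ l' @ y'" "(l', r') \<in> conn P" "l' \<noteq> r'"
      using P.nf_change[OF tuv] P.nf_canonical_word cantu by metis
    have "l = map t (map s l)" using tsw can by simp
    also have "\<dots> = (map t x @ x') @ l' @ (y' @ map t y)" using u(1) l'(1) by simp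
    \<comment> \<open>By C(2) the factor \<open>l'\<close> is all of \<open>l\<close>, so
      \<open>x\<close> and \<open>y\<close> are empty and \<open>map s l\<close> is the relation
      word \<open>u\<close>.\<close>
    finally have "map t x @ x' = []" "y' @ map t y = []"
      using P.relation_word_factor[of "map t x @ x'" l' "y' @ map t y"] rw
        conn_relation_word(1)[OF l'(2,3)] by simp_all
    then have "map s l = u" using u(1) by simp
    then show ?thesis using Q.pcong_conn[OF slr] uv by simp
  qed simp
  with ts s show ?thesis unfolding transfers_def by blast
qed

text \<open>The bounds on \<open>s\<close> and \<open>t\<close> make the search for them finite.\<close>

lemma presented_iso_imp_transfers:
  assumes "C2_presentation P" "C2_presentation Q" "presented_iso P Q"
  shows "\<exists>s t. (\<forall>a. s a \<le> fst Q) \<and> (\<forall>b. t b \<le> fst P) \<and> transfers s t P Q \<and> transfers t s Q P"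
proof -
  interpret P: C2_presentation P by fact
  interpret Q: C2_presentation Q by fact
  interpret PQ: C2_presentation_pair P Q ..
  interpret QP: C2_presentation_pair Q P ..
  obtain h k where h: "cong_hom P Q h" and k: "cong_hom Q P k"
    and kh: "\<And>u. u \<in> words P \<Longrightarrow> pcong P (k (h u)) u"
    and hk: "\<And>w. w \<in> words Q \<Longrightarrow> pcong Q (h (k w)) w"
    using assms(3) presented_iso_iff_inverse_homs[OF P.wf Q.wf] by blast
  obtain s where s: "\<And>a. canonical P a \<Longrightarrow> canonical Q (s a) \<and> pcong Q (h [a]) [s a]"
    using PQ.iso_canonical_letter[OF h k kh hk] by metis
  obtain t where t: "\<And>b. canonical Q b \<Longrightarrow> canonical P (t b) \<and> pcong P (k [b]) [t b]"
    using QP.iso_canonical_letter[OF k h hk kh] by metis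
  \<comment> \<open>The value 0 off the canonical letters makes the bound hold everywhere without
    affecting the property of \<open>s\<close>.\<close>
  define s' where "s' a = (if canonical P a then s a else 0)" for a
  define t' where "t' b = (if canonical Q b then t b else 0)" for b
  have s': "canonical P a \<Longrightarrow> canonical Q (s' a) \<and> pcong Q (h [a]) [s' a]" "s' a \<le> fst Q" for a
    using s[of a] by (auto simp: s'_def canonical_def)
  have t': "canonical Q b \<Longrightarrow> canonical P (t' b) \<and> pcong P (k [b]) [t' b]" "t' b \<le> fst P" for b
    using t[of b] by (auto simp: t'_def canonical_def)
  show ?thesis
    using iso_transfers[OF assms(1,2) h k kh hk s'(1) t'(1)]
      iso_transfers[OF assms(2,1) k h hk kh t'(1) s'(1)] s'(2) t'(2) by blast
qed

lemma transfers_imp_presented_iso: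
  assumes "C2_presentation P" "C2_presentation Q" "transfers s t P Q" "transfers t s Q P"
  shows "presented_iso P Q"
proof -
  interpret P: C2_presentation P by fact
  interpret Q: C2_presentation Q by fact
  interpret PQ: C2_presentation_pair P Q ..
  interpret QP: C2_presentation_pair Q P ..
  have "pcong P (map t (Q.nf (map s (P.nf u)))) u" if "u \<in> words P" for u
    using PQ.transfers_inverse[OF assms(3) that] P.nf_pcong[OF that] pcong.sym by simp
  moreover have "pcong Q (map s (P.nf (map t (Q.nf w)))) w" if "w \<in> words Q" for w
    using QP.transfers_inverse[OF assms(4) that] Q.nf_pcong[OF that] pcong.sym by simp
  ultimately show ?thesis
    using PQ.transfers_cong_hom[OF assms(3)] QP.transfers_cong_hom[OF assms(4)]
      presented_iso_iff_inverse_homs[OF P.wf Q.wf] by blast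
qed

section \<open>Deciding isomorphism on codes\<close>

text \<open>Defined for every number, so decidability is proved for arbitrary codes and C(2) enters
  only into correctness.\<close>

definition dec_pres :: "nat \<Rightarrow> presentation" where
  "dec_pres p = (fst (prod_decode p),
     map (\<lambda>c. (list_decode (fst (prod_decode c)), list_decode (snd (prod_decode c))))
       (list_decode (snd (prod_decode p))))"

lemma dec_pres_enc_pres [simp]: "dec_pres (enc_pres P) = P"
  by (cases P) (auto simp: dec_pres_def enc_pres_def enc_word_def comp_def split: prod.splits intro!: map_idI)

lemma fst_dec_pres [simp]: "fst (dec_pres p) = fst (prod_decode p)"
  by (simp add: dec_pres_def)

lemma rels_dec_pres:
  "(list_decode l, list_decode r) \<in> rels (dec_pres p) \<longleftrightarrow>
     prod_encode (l, r) \<in> set (list_decode (snd (prod_decode p)))"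
proof -
  have "(list_decode l, list_decode r) =
      (list_decode (fst (prod_decode c)), list_decode (snd (prod_decode c))) \<longleftrightarrow> c = prod_encode (l, r)" for c
    by (metis fst_conv snd_conv list_decode_inverse prod.collapse prod_decode_inverse prod_encode_inverse)
  then show ?thesis by (auto simp: rels_def dec_pres_def image_iff)
qed

text \<open>List codes exceed their entries and pair codes dominate their components. This bounds
  the quantifiers over words below.\<close>

lemma rels_dec_pres_bound:
  assumes "(l, r) \<in> rels (dec_pres p)"
  shows "list_encode l \<le> p" "list_encode r \<le> p"
proof -
  let ?c = "prod_encode (list_encode l, list_encode r)"
  have "?c \<in> set (list_decode (snd (prod_decode p)))"
    using rels_dec_pres[of "list_encode l" "list_encode r" p] assms by simp
  then have "?c < snd (prod_decode p)" using elem_less_list_encode by fastforce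
  also have "\<dots> \<le> p" by (metis le_prod_encode_2 prod.collapse prod_decode_inverse)
  finally have "?c < p" .
  then show "list_encode l \<le> p" "list_encode r \<le> p"
    using le_prod_encode_1[of "list_encode l" "list_encode r"]
      le_prod_encode_2[of "list_encode r" "list_encode l"] by auto
qed

lemma conn_dec_pres_bound:
  assumes "(u, v) \<in> conn (dec_pres p)" "u \<noteq> v"
  shows "list_encode u \<le> p" "list_encode v \<le> p"
  using conn_relation_word[OF assms] by (auto simp: relation_words_def dest: rels_dec_pres_bound)

text \<open>Connectedness as membership in every subset of the codes up to \<open>p\<close> that contains \<open>u\<close>
  and is a union of components; such subsets are coded by short lists.\<close>

lemma conn_dec_pres_iff:
  "(list_decode u, list_decode v) \<in> conn (dec_pres p) \<longleftrightarrow> u = v \<or>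
     (u < Suc p \<and> v < Suc p \<and> (\<forall>S<Suc (list_bound p (Suc p)).
        (\<forall>l<Suc p. \<forall>r<Suc p. prod_encode (l, r) \<in> set (list_decode (snd (prod_decode p))) \<longrightarrow>
           (l \<in> set (list_decode S)) = (r \<in> set (list_decode S))) \<longrightarrow>
        u \<in> set (list_decode S) \<longrightarrow> v \<in> set (list_decode S)))" (is "?L \<longleftrightarrow> u = v \<or> ?R")
proof
  assume L: ?L
  have "v \<in> set (list_decode S)"
    if cl: "\<forall>l<Suc p. \<forall>r<Suc p. prod_encode (l, r) \<in> set (list_decode (snd (prod_decode p))) \<longrightarrow>
           (l \<in> set (list_decode S)) = (r \<in> set (list_decode S))"
      and u: "u \<in> set (list_decode S)" for S
  proof -
    have step: "list_encode x \<in> set (list_decode S) \<longleftrightarrow> list_encode y \<in> set (list_decode S)"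
      if xy: "(x, y) \<in> rels (dec_pres p)" for x y
      using cl rels_dec_pres_bound[OF xy] rels_dec_pres[of "list_encode x" "list_encode y" p] xy
      by (simp add: less_Suc_eq_le)
    have "list_encode w \<in> set (list_decode S)" if "(list_decode u, w) \<in> conn (dec_pres p)" for w
      using that unfolding conn_def
      by (induction rule: rtrancl_induct) (auto simp: u step)
    from this[OF L] show ?thesis by simp
  qed
  moreover have "u \<le> p \<and> v \<le> p" if "u \<noteq> v"
  proof -
    have "list_decode u \<noteq> list_decode v" using that by (metis list_decode_inverse)
    then show ?thesis using conn_dec_pres_bound[OF L] by simp
  qed
  ultimately show "u = v \<or> ?R" by (auto simp: less_Suc_eq_le)
next
  assume R: "u = v \<or> ?R"
  show ?L
  proof (cases "u = v")
    case False
    \<comment> \<open>The test set is the component of \<open>u\<close> itself, restricted to codes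
      up to \<open>p\<close>.\<close>
    define A where "A = {c. c \<le> p \<and> (list_decode u, list_decode c) \<in> conn (dec_pres p)}"
    have A: "A \<subseteq> {..p}" by (auto simp: A_def)
    then have fin: "finite A" using finite_subset by blast
    define S where "S = list_encode (sorted_list_of_set A)"
    have setS: "set (list_decode S) = A" using fin by (simp add: S_def)
    \<comment> \<open>A list of \<open>A\<close> without repetitions then has at most
      \<open>Suc p\<close> entries, each at most \<open>p\<close>.\<close>
    have "card A \<le> Suc p" using card_mono[OF _ A] by simp
    then have "S \<le> list_bound p (Suc p)"
      unfolding S_def using A fin by (intro list_encode_le_list_bound) auto
    moreover have "l \<in> A \<longleftrightarrow> r \<in> A"
      if "l < Suc p" "r < Suc p" "prod_encode (l, r) \<in> set (list_decode (snd (prod_decode p)))" for l r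
    proof -
      have "(list_decode l, list_decode r) \<in> conn (dec_pres p)"
        using that(3) rels_dec_pres conn_rel by blast
      then have "(list_decode u, list_decode l) \<in> conn (dec_pres p) \<longleftrightarrow>
          (list_decode u, list_decode r) \<in> conn (dec_pres p)"
        using conn_trans conn_sym by metis
      then show ?thesis using that by (simp add: A_def less_Suc_eq_le)
    qed
    moreover have "u \<in> A" using R False by (auto simp: A_def)
    moreover have ?R using R False by simp
    ultimately have "v \<in> A"
      using conjunct2[OF conjunct2[OF \<open>?R\<close>], THEN spec[of _ S]] by (simp add: setS less_Suc_eq_le)
    then show ?thesis by (simp add: A_def)
  qed simp
qed

section \<open>Deciding the criterion\<close>

lemma decidable_in_conn:
  assumes "recursive_in \<Gamma> p" "recursive_in \<Gamma> u" "recursive_in \<Gamma> v"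
  shows "decidable_in \<Gamma> (\<lambda>e. (list_decode (u e), list_decode (v e)) \<in> conn (dec_pres (p e)))"
proof -
  have "decidable_in [fst, \<lambda>x. fst (snd x), \<lambda>x. snd (snd x)]
      (\<lambda>x. (list_decode (fst (snd x)), list_decode (snd (snd x))) \<in> conn (dec_pres (fst x)))"
    unfolding conn_dec_pres_iff
    by (intro recursive_intros decidable_in_mem_list_decode recursive_in_prod_encode
        recursive_in_snd_prod_decode recursive_in_list_bound) (simp_all add: recursive_in_var)
  from decidable_in_compose[OF this, of \<Gamma> "\<lambda>e. (p e, u e, v e)"] assms show ?thesis by simp
qed

text \<open>\<open>Suc (prod_encode (a, 0))\<close> is the code of the word \<open>[a]\<close>. Any
  other word connected to \<open>[a]\<close> has a code up to \<open>p\<close>.\<close>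

lemma canonical_dec_pres_iff:
  "canonical (dec_pres p) a \<longleftrightarrow> a < fst (prod_decode p) \<and>
     (\<forall>w<Suc p. (list_decode (Suc (prod_encode (a, 0))), list_decode w) \<in> conn (dec_pres p) \<longrightarrow>
        length (list_decode w) < 2) \<and>
     (\<forall>b<a. \<not> (list_decode (Suc (prod_encode (b, 0))), list_decode (Suc (prod_encode (a, 0))))
        \<in> conn (dec_pres p))"
proof -
  have "length w < 2" if "\<forall>w<Suc p. ([a], list_decode w) \<in> conn (dec_pres p) \<longrightarrow> length (list_decode w) < 2"
    "([a], w) \<in> conn (dec_pres p)" for w
    using that(1)[rule_format, of "list_encode w"] that(2) conn_dec_pres_bound(2)[OF that(2)]
    by (cases "[a] = w") (auto simp: less_Suc_eq_le)
  then show ?thesis unfolding canonical_def by (auto 4 3)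
qed

lemma decidable_in_canonical:
  assumes "recursive_in \<Gamma> p" "recursive_in \<Gamma> a"
  shows "decidable_in \<Gamma> (\<lambda>e. canonical (dec_pres (p e)) (a e))"
proof -
  have "decidable_in [fst, snd] (\<lambda>x. canonical (dec_pres (fst x)) (snd x))"
    unfolding canonical_dec_pres_iff
    by (intro recursive_intros decidable_in_conn recursive_in_prod_encode
        recursive_in_fst_prod_decode recursive_in_length_list_decode) (simp_all add: recursive_in_var)
  from decidable_in_compose[OF this, of \<Gamma> "\<lambda>e. (p e, a e)"] assms show ?thesis by simp
qed

text \<open>Equal words have equal images, and distinct connected words have codes up to
  \<open>p\<close>. Encoding the images before decoding them fits the shape of
  \<open>decidable_in_conn\<close>.\<close>

lemma transfers_dec_pres_iff:
  "transfers (code_nth s) (code_nth t) (dec_pres p) (dec_pres q) \<longleftrightarrow>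
     (\<forall>a<fst (prod_decode p). canonical (dec_pres p) a \<longrightarrow>
        canonical (dec_pres q) (code_nth s a) \<and> code_nth t (code_nth s a) = a) \<and>
     (\<forall>l<Suc p. \<forall>r<Suc p. (list_decode l, list_decode r) \<in> conn (dec_pres p) \<longrightarrow>
        2 \<le> length (list_decode l) \<longrightarrow> 2 \<le> length (list_decode r) \<longrightarrow>
        (list_decode (list_encode (map (code_nth s) (list_decode l))),
         list_decode (list_encode (map (code_nth s) (list_decode r)))) \<in> conn (dec_pres q))"
    (is "_ \<longleftrightarrow> ?A \<and> ?B")
proof -
  have "(map (code_nth s) l, map (code_nth s) r) \<in> conn (dec_pres q)"
    if ?B and lr: "(l, r) \<in> conn (dec_pres p)" "2 \<le> length l" "2 \<le> length r" for l r
  proof (cases "l = r")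
    case False
    then show ?thesis
      using \<open>?B\<close>[rule_format, of "list_encode l" "list_encode r"] lr conn_dec_pres_bound[OF lr(1)]
      by (simp add: less_Suc_eq_le)
  qed simp
  moreover have "a < fst (prod_decode p)" if "canonical (dec_pres p) a" for a
    using that by (simp add: canonical_def)
  ultimately show ?thesis unfolding transfers_def by auto
qed

lemma decidable_in_transfers:
  assumes "recursive_in \<Gamma> s" "recursive_in \<Gamma> t" "recursive_in \<Gamma> p" "recursive_in \<Gamma> q"
  shows "decidable_in \<Gamma> (\<lambda>e. transfers (code_nth (s e)) (code_nth (t e)) (dec_pres (p e)) (dec_pres (q e)))"
proof -
  have "decidable_in [fst, \<lambda>x. fst (snd x), \<lambda>x. fst (snd (snd x)), \<lambda>x. snd (snd (snd x))]
      (\<lambda>x. transfers (code_nth (fst x)) (code_nth (fst (snd x)))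
         (dec_pres (fst (snd (snd x)))) (dec_pres (snd (snd (snd x)))))"
    unfolding transfers_dec_pres_iff
    by (intro recursive_intros decidable_in_conn decidable_in_canonical recursive_in_code_nth
        recursive_in_map_code_nth recursive_in_fst_prod_decode recursive_in_length_list_decode)
      (simp_all add: recursive_in_var)
  from decidable_in_compose[OF this, of \<Gamma> "\<lambda>e. (s e, t e, p e, q e)"] assms show ?thesis by simp
qed

text \<open>Canonical letters and letters of relation words are at most the code of their
  presentation, so a finite table of each map is enough.\<close>

lemma transfers_cong:
  assumes "\<And>a. a \<le> p \<Longrightarrow> s a = s' a" "\<And>b. b \<le> q \<Longrightarrow> t b = t' b"
    and "transfers s t (dec_pres p) (dec_pres q)"
  shows "transfers s' t' (dec_pres p) (dec_pres q)"
proof -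
  have fst_le: "fst (prod_decode n) \<le> n" for n
    by (metis le_prod_encode_1 prod.collapse prod_decode_inverse)
  have "a \<le> n" if "canonical (dec_pres n) a" for a n
    using that fst_le[of n] by (simp add: canonical_def)
  moreover have "(map s' l, map s' r) \<in> conn (dec_pres q)"
    if lr: "(l, r) \<in> conn (dec_pres p)" "2 \<le> length l" "2 \<le> length r" for l r
  proof (cases "l = r")
    case False
    have "map s' w = map s w" if "list_encode w \<le> p" for w
      using that assms(1) elem_less_list_encode[of _ w] by fastforce
    then have "map s' l = map s l" "map s' r = map s r"
      using conn_dec_pres_bound[OF lr(1) False] by auto
    then show ?thesis using assms(3) lr unfolding transfers_def by metis
  qed simp
  ultimately show ?thesis using assms unfolding transfers_def by metis
qed

section \<open>The finite search\<close>

theorem theorem2: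
  shows "\<exists>f :: recf. \<forall>P Q. well_formed P \<longrightarrow> well_formed Q \<longrightarrow> C2 P \<longrightarrow> C2 Q \<longrightarrow>
           eval f [enc_pres P, enc_pres Q] (if presented_iso P Q then 1 else 0)"
proof -
  \<comment> \<open>Each table is searched among lists of at most \<open>p + q + 1\<close> entries,
    all at most \<open>p + q\<close>; this covers tables up to \<open>p\<close> and up to
    \<open>q\<close> alike.\<close>
  define D where "D p q \<longleftrightarrow> (\<exists>s<Suc (list_bound (p + q) (Suc (p + q))).
     \<exists>t<Suc (list_bound (p + q) (Suc (p + q))).
       transfers (code_nth s) (code_nth t) (dec_pres p) (dec_pres q) \<and>
       transfers (code_nth t) (code_nth s) (dec_pres q) (dec_pres p))" for p q
  have "decidable_in [fst, snd] (\<lambda>x. D (fst x) (snd x))"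
    unfolding D_def
    by (intro recursive_intros decidable_in_transfers recursive_in_list_bound)
      (simp_all add: recursive_in_var)
  then obtain f where f: "\<And>p q. eval f [p, q] (if D p q then 1 else 0)"
    unfolding decidable_in_def recursive_in_def by fastforce
  have "presented_iso P Q \<longleftrightarrow> D (enc_pres P) (enc_pres Q)"
    if "well_formed P" "well_formed Q" "C2 P" "C2 Q" for P Q
  proof
    have PQ: "C2_presentation P" "C2_presentation Q" using that by unfold_locales
    let ?p = "enc_pres P" and ?q = "enc_pres Q"
    show "presented_iso P Q" if "D ?p ?q"
      using that transfers_imp_presented_iso[OF PQ] by (auto simp: D_def)
    assume "presented_iso P Q"
    then obtain s t where st: "\<And>a. s a \<le> fst Q" "\<And>b. t b \<le> fst P"
      "transfers s t P Q" "transfers t s Q P"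
      using presented_iso_imp_transfers[OF PQ] by blast
    \<comment> \<open>The tables reach up to the codes themselves, which are at least the alphabet
      sizes.\<close>
    define s' where "s' = list_encode (map s [0..<Suc ?p])"
    define t' where "t' = list_encode (map t [0..<Suc ?q])"
    have s': "code_nth s' a = s a" if "a \<le> ?p" for a
      using that by (simp add: s'_def code_nth_def del: upt_Suc)
    have t': "code_nth t' b = t b" if "b \<le> ?q" for b
      using that by (simp add: t'_def code_nth_def del: upt_Suc)
    have "fst P \<le> ?p" "fst Q \<le> ?q"
      unfolding enc_pres_def by (rule le_prod_encode_1)+
    then have bd: "s a \<le> ?p + ?q" "t a \<le> ?p + ?q" for a
      using st(1,2)[of a] by linarith+
    have "s' \<le> list_bound (?p + ?q) (Suc (?p + ?q))" "t' \<le> list_bound (?p + ?q) (Suc (?p + ?q))"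
      unfolding s'_def t'_def using bd by (intro list_encode_le_list_bound; auto)+
    moreover have "transfers (code_nth s') (code_nth t') (dec_pres ?p) (dec_pres ?q)"
      by (rule transfers_cong[of ?p s _ ?q t]) (simp_all add: s' t' st)
    moreover have "transfers (code_nth t') (code_nth s') (dec_pres ?q) (dec_pres ?p)"
      by (rule transfers_cong[of ?q t _ ?p s]) (simp_all add: s' t' st)
    ultimately show "D ?p ?q" unfolding D_def by (auto simp: less_Suc_eq_le)
  qed
  then show ?thesis using f by (intro exI[of _ f]) auto
qed

end
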